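(* For arbitrary integers $a,b\in\mathbb{Z}$, we have $$\sum_{r=0}^\infty [r+1]_{q^{a}}\,[r+1]_{q^{b}}\,t^r=\frac{1-q^{a+b}t^2}{(1-t)(1-q^{a}t)(1-q^{b}t)(1-q^{a+b}t)}.$$
   Context: For a positive integer $k$, $[k]_q=\frac{1-q^k}{1-q}=1+q+\cdots+q^{k-1}$ is the $q$-integer, and $[k]_{q^a}=\sum_{i=0}^{k-1}q^{ia}$ is the result of substituting $q^a$ for $q$ (so $[k]_{q^0}=k$). The identity is one of formal power series in $t$ with coefficients in $\mathbb{Z}[q,q^{-1}]$. *)

theory Defs
  imports "HOL-Computational_Algebra.Formal_Power_Series" "HOL-Library.Poly_Mapping"
begin

text \<open>
  The Laurent polynomial ring \<open>\<int>[q, q\<^sup>-\<^sup>1]\<close> is the group ring of the additive group of integers: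
  finitely supported functions \<open>\<int> \<Rightarrow> \<int>\<close> (exponent to coefficient) under convolution.
\<close>

type_synonym laurent = "int \<Rightarrow>\<^sub>0 int"

definition qpow :: "int \<Rightarrow> laurent"
  where "qpow a = Poly_Mapping.single a 1"

lemma qpow_0: "qpow 0 = 1"
  by (simp add: qpow_def)

lemma qpow_add: "qpow (a + b) = qpow a * qpow b"
  by (simp add: qpow_def mult_single)

text \<open>\<open>qint a k\<close> is \<open>[k]\<close> with \<open>q\<close> replaced by \<open>q\<^sup>a\<close>.\<close>

definition qint :: "int \<Rightarrow> nat \<Rightarrow> laurent"
  where "qint a k = (\<Sum>i<k. qpow (int i * a))"

lemma qint_0: "qint 0 k = of_nat k"
  by (simp add: qint_def qpow_0)

lemma qint_geometric: "(1 - qpow a) * qint a k = 1 - qpow (int k * a)"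
proof (induction k)
  case 0
  show ?case by (simp add: qint_def qpow_0)
next
  case (Suc k)
  have "qint a (Suc k) = qint a k + qpow (int k * a)"
    by (simp add: qint_def)
  moreover have "qpow (int (Suc k) * a) = qpow a * qpow (int k * a)"
    by (simp add: qpow_add [symmetric] algebra_simps)
  ultimately have "(1 - qpow a) * qint a (Suc k) =
      (1 - qpow a) * qint a k + qpow (int k * a) - qpow (int (Suc k) * a)"
    by (simp only: distrib_left left_diff_distrib mult_1_left) simp
  then show ?case
    by (simp only: Suc.IH) simp
qed

text \<open>
  The library division on formal power series needs an inverse operation on the coefficients,
  which Laurent polynomials do not have. A series with constant term 1 is nevertheless a unit
  over any commutative ring; \<open>fps_frac f g\<close> is meant only for such \<open>g\<close>.
\<close>

definition fps_frac :: "'a::comm_ring_1 fps \<Rightarrow> 'a fps \<Rightarrow> 'a fps"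
  where "fps_frac f g = f * fps_right_inverse g 1"

lemma fps_frac_eq_iff:
  fixes f g h :: "'a::comm_ring_1 fps"
  assumes "fps_nth g 0 = 1"
  shows "h = fps_frac f g \<longleftrightarrow> h * g = f"
proof -
  have inv: "g * fps_right_inverse g 1 = 1"
    by (rule fps_right_inverse) (simp add: assms)
  show ?thesis
  proof
    assume "h = fps_frac f g"
    then have "h * g = f * (g * fps_right_inverse g 1)"
      by (simp add: fps_frac_def mult_ac)
    then show "h * g = f" by (simp only: inv mult_1_right)
  next
    assume f: "h * g = f"
    have "fps_frac f g = h * (g * fps_right_inverse g 1)"
      by (simp only: fps_frac_def f [symmetric] mult_ac)
    then show "h = fps_frac f g" by (simp only: inv mult_1_right)
  qed
qed

end

theory Submission
  imports Defs
begin

text \<open>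
  Put \<open>x = q\<^sup>a\<close> and \<open>y = q\<^sup>b\<close>. The identity holds for any two elements of a commutative ring, so
  that the cases \<open>a = 0\<close> and \<open>b = 0\<close>, where \<open>1 - q\<^sup>a\<close> or \<open>1 - q\<^sup>b\<close> vanishes, need no separate
  treatment: instead of the quotient \<open>(1 - x\<^sup>k) / (1 - x)\<close> one uses the recurrence
  \<open>A\<^sub>k\<^sub>+\<^sub>1 = x A\<^sub>k + 1\<close> for \<open>A\<^sub>k = 1 + x + \<dots> + x\<^sup>k\<close>.

  Let \<open>B\<^sub>k\<close> be the same sum for \<open>y\<close>, let \<open>F\<close>, \<open>G\<close> and \<open>S\<close> be the generating functions of \<open>A\<^sub>k\<close>,
  \<open>B\<^sub>k\<close> and \<open>A\<^sub>k B\<^sub>k\<close>, and let \<open>E = 1 / (1 - t)\<close>. The recurrence says \<open>(1 - x t) F = E\<close> and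
  \<open>(1 - y t) G = E\<close>; multiplying the recurrences for \<open>A\<close> and \<open>B\<close> gives
  \<open>A\<^sub>k\<^sub>+\<^sub>1 B\<^sub>k\<^sub>+\<^sub>1 = x y A\<^sub>k B\<^sub>k + x A\<^sub>k + y B\<^sub>k + 1\<close>, that is,
  \<open>(1 - x y t) S = x t F + y t G + E\<close>. Multiplying by \<open>(1 - t) (1 - x t) (1 - y t)\<close> leaves
  \<open>x t (1 - y t) + y t (1 - x t) + (1 - x t) (1 - y t) = 1 - x y t\<^sup>2\<close>.
\<close>

lemma fps_ones_times_one_minus_X:
  "(1 - fps_X) * Abs_fps (\<lambda>_. 1) = (1 :: 'a::comm_ring_1 fps)"
proof (rule fps_ext)
  fix n
  show "fps_nth ((1 - fps_X) * Abs_fps (\<lambda>_. 1)) n = fps_nth (1 :: 'a fps) n"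
    by (cases n) (simp_all add: left_diff_distrib)
qed

lemma geometric_sum_Suc:
  fixes x :: "'a::comm_ring_1"
  shows "(\<Sum>i<Suc n. x ^ i) = x * (\<Sum>i<n. x ^ i) + 1"
  by (subst sum.lessThan_Suc_shift) (simp add: sum_distrib_left)

lemma fps_geometric_sums:
  fixes x :: "'a::comm_ring_1"
  shows "(1 - fps_const x * fps_X) * Abs_fps (\<lambda>n. \<Sum>i<Suc n. x ^ i) = Abs_fps (\<lambda>_. 1)"
proof (rule fps_ext)
  fix n
  show "fps_nth ((1 - fps_const x * fps_X) * Abs_fps (\<lambda>n. \<Sum>i<Suc n. x ^ i)) n =
    fps_nth (Abs_fps (\<lambda>_. 1)) n"
    by (cases n) (simp_all add: left_diff_distrib mult.assoc geometric_sum_Suc del: sum.lessThan_Suc)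
qed

lemma fps_product_geometric_sums_recurrence:
  fixes x y :: "'a::comm_ring_1"
  defines "A \<equiv> \<lambda>n. \<Sum>i<Suc n. x ^ i" and "B \<equiv> \<lambda>n. \<Sum>i<Suc n. y ^ i"
  shows "(1 - fps_const (x * y) * fps_X) * Abs_fps (\<lambda>n. A n * B n) =
    fps_const x * fps_X * Abs_fps A + fps_const y * fps_X * Abs_fps B + Abs_fps (\<lambda>_. 1)"
    (is "?L = ?R")
proof (rule fps_ext)
  fix n
  show "fps_nth ?L n = fps_nth ?R n"
  proof (cases n)
    case 0
    then show ?thesis by (simp add: A_def B_def mult.assoc)
  next
    case (Suc m)
    have "A (Suc m) = x * A m + 1" "B (Suc m) = y * B m + 1"
      unfolding A_def B_def by (rule geometric_sum_Suc)+
    with Suc show ?thesis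
      by (simp add: left_diff_distrib mult.assoc) (simp add: algebra_simps)
  qed
qed

text \<open>
  The elimination of \<open>E\<close>, \<open>F\<close> and \<open>G\<close> in the last step: it is to be read with \<open>u = x t\<close>,
  \<open>v = y t\<close> and \<open>w = x y t\<close>, so that \<open>u v\<close> is \<open>x y t\<^sup>2\<close>. It uses no cancellation, hence
  holds in every commutative ring, zero divisors included.
\<close>

lemma clear_denominators:
  fixes e f g s t u v w :: "'a::comm_ring_1"
  assumes e: "(1 - t) * e = 1" and f: "(1 - u) * f = e" and g: "(1 - v) * g = e"
    and s: "(1 - w) * s = u * f + v * g + e"
  shows "s * ((1 - t) * (1 - u) * (1 - v) * (1 - w)) = 1 - u * v"
proof -
  have "s * ((1 - t) * (1 - u) * (1 - v) * (1 - w)) =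
      (1 - t) * (1 - u) * (1 - v) * ((1 - w) * s)"
    by (simp only: mult_ac)
  also have "\<dots> = (1 - t) * (u * (1 - v) * ((1 - u) * f) + v * (1 - u) * ((1 - v) * g)
      + (1 - u) * (1 - v) * e)"
    unfolding s by (simp only: distrib_left mult_ac)
  also have "\<dots> = ((1 - t) * e) * (u * (1 - v) + v * (1 - u) + (1 - u) * (1 - v))"
    unfolding f g by (simp only: distrib_left mult_ac)
  also have "\<dots> = 1 - u * v"
    unfolding e by (simp add: algebra_simps)
  finally show ?thesis .
qed

lemma fps_product_geometric_sums:
  fixes x y :: "'a::comm_ring_1"
  shows "Abs_fps (\<lambda>n. (\<Sum>i<Suc n. x ^ i) * (\<Sum>i<Suc n. y ^ i)) *
      ((1 - fps_X) * (1 - fps_const x * fps_X) * (1 - fps_const y * fps_X) *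
       (1 - fps_const (x * y) * fps_X)) =
    1 - fps_const (x * y) * fps_X ^ 2"
proof -
  have "fps_const (x * y) * fps_X ^ 2 = (fps_const x * fps_X) * (fps_const y * fps_X)"
    by (simp only: fps_const_mult [symmetric] power2_eq_square mult_ac)
  then show ?thesis
    using clear_denominators [OF fps_ones_times_one_minus_X fps_geometric_sums fps_geometric_sums
        fps_product_geometric_sums_recurrence]
    by (simp only:)
qed

lemma qpow_of_nat_mult: "qpow (int n * a) = qpow a ^ n"
  by (induction n) (simp_all add: qpow_0 qpow_add distrib_right)

lemma qint_eq_geometric_sum: "qint a n = (\<Sum>i<n. qpow a ^ i)"
  by (simp add: qint_def qpow_of_nat_mult)

theorem corollary2p4:
  fixes a b :: int
  shows "Abs_fps (\<lambda>r. qint a (r + 1) * qint b (r + 1)) =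
    fps_frac (1 - fps_const (qpow (a + b)) * fps_X ^ 2)
      ((1 - fps_X) * (1 - fps_const (qpow a) * fps_X) *
       (1 - fps_const (qpow b) * fps_X) * (1 - fps_const (qpow (a + b)) * fps_X))"
proof (subst fps_frac_eq_iff)
  show "fps_nth ((1 - fps_X) * (1 - fps_const (qpow a) * fps_X) *
       (1 - fps_const (qpow b) * fps_X) * (1 - fps_const (qpow (a + b)) * fps_X)) 0 = 1"
    by simp
  show "Abs_fps (\<lambda>r. qint a (r + 1) * qint b (r + 1)) *
      ((1 - fps_X) * (1 - fps_const (qpow a) * fps_X) *
       (1 - fps_const (qpow b) * fps_X) * (1 - fps_const (qpow (a + b)) * fps_X)) =
    1 - fps_const (qpow (a + b)) * fps_X ^ 2"
    unfolding qint_eq_geometric_sum qpow_add Suc_eq_plus1 [symmetric]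
    by (rule fps_product_geometric_sums)
qed

end
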